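(* Let $(k,l,m)$ be any triple of integers. The pair $(Q,R)$ of rational functions of $a,b,c,q$ and $x$ satisfying the three term relation $$\phi(aq^{k},bq^{l};cq^{m};q,x)=Q\cdot\phi(aq,bq;cq;q,x)+R\cdot\phi(a,b;c;q,x)$$ is uniquely determined by $(k,l,m)$. That is, if $(Q_1,R_1)$ and $(Q_2,R_2)$ are two pairs of rational functions of $a,b,c,q,x$ which both satisfy this relation (identically in $a,b,c,q,x$), then $Q_1=Q_2$ and $R_1=R_2$.
   Context: Here $q$ is a complex number with $0<|q|<1$, and $a,b,c$ are nonzero complex parameters. Put $(u)_\infty=\prod_{n\ge 0}(1-uq^n)$ and $(u)_n=(u)_\infty/(uq^n)_\infty$ for $n\in\mathbb{Z}$; i.e. $(u)_n=\prod_{j=0}^{n-1}(1-uq^j)$ for $n\ge0$ and $(u)_{-n}=\prod_{j=1}^{n}(1-uq^{-j})^{-1}$ for $n>0$. The basic hypergeometric series is $$\phi(a,b;c;q,x)=\sum_{n=0}^\infty\frac{(a)_n(b)_n}{(q)_n(c)_n}x^n .$$ Standing assumptions on parameter values: E1: $c,\ a/b\notin q^{\mathbb{Z}}$; E2: $a,\ b,\ c/a,\ c/b\notin q^{\mathbb{Z}}$. Rational functions of $a,b,c,q,x$ are elements of the field $\mathbb{Q}(a,b,c,q,x)$ of rational functions in these variables; the relation is understood as an identity holding for all parameter values and all $|x|<1$ for which both sides are defined. *)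

theory Defs
  imports Complex_Main "HOL-Computational_Algebra.Polynomial"
    "HOL-Computational_Algebra.Fraction_Field"
begin

definition qpoch :: "complex \<Rightarrow> complex \<Rightarrow> nat \<Rightarrow> complex" where
  "qpoch q u n = (\<Prod>j<n. 1 - u * q ^ j)"

definition qphi :: "complex \<Rightarrow> complex \<Rightarrow> complex \<Rightarrow> complex \<Rightarrow> complex \<Rightarrow> complex" where
  "qphi a b c q x =
     (\<Sum>n. qpoch q a n * qpoch q b n / (qpoch q q n * qpoch q c n) * x ^ n)"

definition qpowers :: "complex \<Rightarrow> complex set" where
  "qpowers q = range (\<lambda>n::int. q powi n)"

definition admissible :: "complex \<Rightarrow> complex \<Rightarrow> complex \<Rightarrow> complex \<Rightarrow> bool" where
  "admissible a b c q \<longleftrightarrow>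
     0 < norm q \<and> norm q < 1 \<and> a \<noteq> 0 \<and> b \<noteq> 0 \<and> c \<noteq> 0 \<and>
     c \<notin> qpowers q \<and> a / b \<notin> qpowers q \<and>
     a \<notin> qpowers q \<and> b \<notin> qpowers q \<and> c / a \<notin> qpowers q \<and> c / b \<notin> qpowers q"

text \<open>The ring \<open>\<rat>[a,b,c,q,x]\<close> is represented as \<open>\<rat>[a][b][c][q][x]\<close>, the innermost
  polynomial variable being \<open>a\<close> and the outermost one \<open>x\<close>.\<close>

type_synonym poly5 = "rat poly poly poly poly poly"

type_synonym ratfun5 = "poly5 fract"

definition eval_poly5 ::
    "complex \<Rightarrow> complex \<Rightarrow> complex \<Rightarrow> complex \<Rightarrow> complex \<Rightarrow> poly5 \<Rightarrow> complex" where
  "eval_poly5 a b c q x P =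
     poly (map_poly (\<lambda>P4. poly (map_poly (\<lambda>P3. poly (map_poly (\<lambda>P2. poly (map_poly
       (\<lambda>P1. poly (map_poly of_rat P1) a) P2) b) P3) c) P4) q) P) x"

text \<open>A rational function is defined at a point if some representation of it as a fraction has a
  denominator not vanishing there; its value does not depend on the chosen representation.\<close>

definition has_value_at ::
    "ratfun5 \<Rightarrow> complex \<Rightarrow> complex \<Rightarrow> complex \<Rightarrow> complex \<Rightarrow> complex \<Rightarrow> complex \<Rightarrow> bool" where
  "has_value_at F a b c q x v \<longleftrightarrow>
     (\<exists>N D. F = Fract N D \<and> eval_poly5 a b c q x D \<noteq> 0 \<and>
            v = eval_poly5 a b c q x N / eval_poly5 a b c q x D)"

text \<open>For admissible parameters and \<open>norm x < 1\<close> all three series are defined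
  because \<open>c\<close> is not an integral power of \<open>q\<close>, so only the rational functions
  can fail to be defined.\<close>

definition three_term_relation ::
    "int \<Rightarrow> int \<Rightarrow> int \<Rightarrow> ratfun5 \<Rightarrow> ratfun5 \<Rightarrow> bool" where
  "three_term_relation k l m Q R \<longleftrightarrow>
     (\<forall>a b c q x vQ vR.
        admissible a b c q \<longrightarrow> norm x < 1 \<longrightarrow>
        has_value_at Q a b c q x vQ \<longrightarrow> has_value_at R a b c q x vR \<longrightarrow>
        qphi (a * q powi k) (b * q powi l) (c * q powi m) q x =
          vQ * qphi (a * q) (b * q) (c * q) q x + vR * qphi a b c q x)"

end

theory Submission
  imports Defs "HOL-Analysis.FPS_Convergence"
begin

text \<open>Subtracting the two relations and clearing denominators turns the claim into an independence
  statement: if \<open>U\<close> and \<open>V\<close> are polynomials in \<open>a, b, c, q, x\<close> with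
  \<open>U \<phi>(aq, bq; cq; q, x) + V \<phi>(a, b; c; q, x) = 0\<close> for all admissible parameters and
  \<open>\<bar>x\<bar> < 1\<close>, then \<open>U = V = 0\<close>. The common denominator is also multiplied into \<open>U\<close> and \<open>V\<close>,
  so the relation holds trivially at the points where it vanishes, and no
  exceptional set has to be carried along.

  The heart of the matter is that already for one fixed admissible quadruple \<open>(a, b, c, q)\<close> the two
  series are linearly independent over the polynomials in \<open>x\<close> (lemma \<open>qphi_independent\<close>). There is
  a sequence \<open>e\<^sub>n\<close> of nonzero numbers such that, with \<open>z = q\<^sup>n\<close>, the \<open>n\<close>th coefficients of the two
  series are \<open>const (1 - az)(1 - bz) e\<^sub>n\<close> and \<open>(1 - cz) e\<^sub>n\<close>; and \<open>e\<^sub>n\<^sub>-\<^sub>1 / e\<^sub>n\<close> is a rational function of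
  \<open>z\<close>. For large \<open>n\<close> the vanishing of the coefficient of \<open>x\<^sup>n\<close> in the relation therefore says that one
  fixed polynomial vanishes at \<open>z = q\<^sup>n\<close>. Since the powers of \<open>q\<close> are infinitely many, it is the zero
  polynomial. Evaluating it at \<open>z = q\<^sup>d/a\<close> and \<open>z = q\<^sup>d/b\<close>, where most summands vanish,
  shows that the coefficients of \<open>x\<^sup>d\<close> in \<open>U\<close> and \<open>V\<close> are zero, starting from the largest \<open>d\<close>
  (lemma \<open>cleared_eq_0D\<close>). Admissibility is what keeps the factors met on the way from vanishing.

  To return to polynomials in five variables, the admissible quadruples must be Zariski
  dense. With \<open>q\<close> in \<open>(0, 1)\<close> all powers of \<open>q\<close> are positive reals, so it suffices to put \<open>a\<close>, \<open>b\<close>,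
  \<open>c\<close> on the rays through \<open>\<i>\<close>, \<open>-1\<close>, \<open>-\<i>\<close>: neither they nor their ratios
  in the admissibility condition are then positive reals.\<close>

section \<open>Evaluation homomorphisms\<close>

definition semiring_hom :: "('r::comm_ring_1 \<Rightarrow> complex) \<Rightarrow> bool" where
  "semiring_hom e \<longleftrightarrow>
     e 0 = 0 \<and> (\<forall>r s. e (r + s) = e r + e s) \<and> (\<forall>r s. e (r * s) = e r * e s)"

definition eval_at :: "('r::comm_ring_1 \<Rightarrow> complex) \<Rightarrow> complex \<Rightarrow> 'r poly \<Rightarrow> complex" where
  "eval_at e x P = poly (map_poly e P) x"

lemma semiring_hom_0: "semiring_hom e \<Longrightarrow> e 0 = 0"
  and semiring_hom_add: "semiring_hom e \<Longrightarrow> e (r + s) = e r + e s"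
  and semiring_hom_mult: "semiring_hom e \<Longrightarrow> e (r * s) = e r * e s"
  by (simp_all add: semiring_hom_def)

lemma semiring_hom_diff:
  assumes "semiring_hom e"
  shows "e (r - s) = e r - e s"
  using semiring_hom_add[OF assms, of "r - s" s] by simp

lemma semiring_hom_eval_at:
  assumes e: "semiring_hom e"
  shows "semiring_hom (eval_at e x)"
proof -
  note e0 = semiring_hom_0[OF e]
  have 0: "eval_at e x 0 = 0"
    by (simp add: eval_at_def)
  have add: "eval_at e x (P + P') = eval_at e x P + eval_at e x P'" for P P'
  proof -
    have "map_poly e (P + P') = map_poly e P + map_poly e P'"
      by (rule poly_eqI) (simp add: coeff_map_poly e0 semiring_hom_add[OF e])
    then show ?thesis by (simp add: eval_at_def)
  qed
  have smult: "eval_at e x (smult r P) = e r * eval_at e x P" for r P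
  proof -
    have "map_poly e (smult r P) = smult (e r) (map_poly e P)"
      by (rule poly_eqI) (simp add: coeff_map_poly e0 semiring_hom_mult[OF e])
    then show ?thesis by (simp add: eval_at_def)
  qed
  have pCons: "eval_at e x (pCons r P) = e r + x * eval_at e x P" for r P
    by (simp add: eval_at_def map_poly_pCons e0)
  have mult: "eval_at e x (P * P') = eval_at e x P * eval_at e x P'" for P P'
    by (induction P) (simp_all add: 0 add smult pCons e0 algebra_simps)
  show ?thesis
    unfolding semiring_hom_def using 0 add mult by blast
qed

lemma semiring_hom_of_rat: "semiring_hom of_rat"
  by (simp add: semiring_hom_def of_rat_add of_rat_mult)

text \<open>A family of homomorphisms separates when only \<open>0\<close> is killed by all its members. For
  evaluations of polynomials this is Zariski density of the points of evaluation, in a form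
  that can be built up one variable at a time.\<close>

definition separating :: "('r::comm_ring_1 \<Rightarrow> complex) set \<Rightarrow> bool" where
  "separating E \<longleftrightarrow> (\<forall>e\<in>E. semiring_hom e) \<and> (\<forall>r. (\<forall>e\<in>E. e r = 0) \<longrightarrow> r = 0)"

definition eval_family :: "('r::comm_ring_1 \<Rightarrow> complex) set \<Rightarrow> complex set \<Rightarrow> ('r poly \<Rightarrow> complex) set"
  where "eval_family E X = {eval_at e x | e x. e \<in> E \<and> x \<in> X}"

lemma ball_eval_family:
  "(\<forall>e'\<in>eval_family E X. R e') \<longleftrightarrow> (\<forall>e\<in>E. \<forall>x\<in>X. R (eval_at e x))"
  by (auto simp: eval_family_def)

text \<open>A member of the old family sends a polynomial killed by the new one to a complex polynomial
  with infinitely many roots, so it kills all of its coefficients.\<close>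

lemma separating_eval_family:
  assumes E: "separating E" and X: "infinite X"
  shows "separating (eval_family E X)"
  unfolding separating_def
proof (intro conjI allI impI)
  show "\<forall>e'\<in>eval_family E X. semiring_hom e'"
    using E by (simp add: ball_eval_family separating_def semiring_hom_eval_at)
next
  fix P assume P: "\<forall>e'\<in>eval_family E X. e' P = 0"
  have "e (coeff P n) = 0" if e: "e \<in> E" for e n
  proof -
    have "eval_at e x P = 0" if "x \<in> X" for x
      using P e that by (simp add: ball_eval_family)
    then have "X \<subseteq> {x. poly (map_poly e P) x = 0}"
      by (auto simp: eval_at_def)
    then have "infinite {x. poly (map_poly e P) x = 0}"
      using X finite_subset by blast
    then have "map_poly e P = 0"
      using poly_roots_finite by blast
    moreover have "e 0 = 0"
      using E e by (simp add: separating_def semiring_hom_0)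
    ultimately show ?thesis
      by (metis coeff_map_poly coeff_0)
  qed
  then show "P = 0"
    using E by (intro poly_eqI) (simp add: separating_def)
qed

lemma separating_of_rat: "separating {of_rat}"
  by (simp add: separating_def semiring_hom_of_rat)

lemma eval_poly5_eq_eval_at:
  "eval_poly5 a b c q x =
     eval_at (eval_at (eval_at (eval_at (eval_at of_rat a) b) c) q) x"
  by (rule ext) (simp add: eval_poly5_def eval_at_def[abs_def])

lemma semiring_hom_eval_poly5: "semiring_hom (eval_poly5 a b c q x)"
  by (simp add: eval_poly5_eq_eval_at semiring_hom_eval_at semiring_hom_of_rat)


section \<open>Zariski density of the admissible parameters\<close>

lemma qpowers_of_real_pos:
  assumes "0 < s" "u \<in> qpowers (of_real s)"
  shows "\<exists>t>0. u = of_real t"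
proof -
  obtain n where "u = of_real (s powi n)"
    using assms(2) by (auto simp: qpowers_def of_real_power_int)
  then show ?thesis using assms(1) by auto
qed

lemma admissible_on_rays:
  assumes "0 < r1" "0 < r2" "0 < r3" "0 < s" "s < 1"
  shows "admissible (of_real r1 * \<i>) (- of_real r2) (- of_real r3 * \<i>) (of_real s)"
proof -
  have notin: "u \<notin> qpowers (of_real s)" if "Im u \<noteq> 0 \<or> Re u \<le> 0" for u
    using qpowers_of_real_pos[OF \<open>0 < s\<close>, of u] that by auto
  have "- of_real r3 * \<i> / (of_real r1 * \<i>) = complex_of_real (- (r3 / r1))"
    using assms by (simp add: field_simps)
  then have "- of_real r3 * \<i> / (of_real r1 * \<i>) \<notin> qpowers (of_real s)"
    using assms by (intro notin) simp
  moreover have "of_real r1 * \<i> / (- of_real r2) = complex_of_real (- (r1 / r2)) * \<i>"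
    using assms by (simp add: field_simps)
  then have "of_real r1 * \<i> / (- of_real r2) \<notin> qpowers (of_real s)"
    using assms by (intro notin) simp
  moreover have "- of_real r3 * \<i> / (- of_real r2) = complex_of_real (r3 / r2) * \<i>"
    using assms by (simp add: field_simps)
  then have "- of_real r3 * \<i> / (- of_real r2) \<notin> qpowers (of_real s)"
    using assms by (intro notin) simp
  moreover have "of_real r1 * \<i> \<notin> qpowers (of_real s)"
    "- of_real r2 \<notin> qpowers (of_real s)"
    "- of_real r3 * \<i> \<notin> qpowers (of_real s)"
    using assms by (auto intro!: notin)
  ultimately show ?thesis
    using assms by (simp add: admissible_def)
qed

lemma poly5_eq_0I:
  assumes "\<And>a b c q x. admissible a b c q \<Longrightarrow> eval_poly5 a b c q x P = 0"
  shows "P = 0"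
proof -
  define I where "I = {0<..<1::real}"
  have I: "infinite I"
    by (simp add: I_def infinite_Ioo)
  have inf: "infinite (f ` I)" if "inj f" for f :: "real \<Rightarrow> complex"
    using that I by (meson finite_imageD inj_on_subset subset_UNIV)
  define E where "E = eval_family (eval_family (eval_family (eval_family (eval_family {of_rat}
    ((\<lambda>r. of_real r * \<i>) ` I)) ((\<lambda>r. - of_real r) ` I)) ((\<lambda>r. - of_real r * \<i>) ` I))
    (of_real ` I)) (of_real ` I)"
  have "separating E"
    unfolding E_def by (intro separating_eval_family separating_of_rat inf) (simp_all add: inj_def)
  moreover have "\<forall>e\<in>E. e P = 0"
    unfolding E_def ball_eval_family
  proof (intro ballI)
    fix e and a b c q x :: complex
    assume e: "e \<in> {complex_of_rat}"
    assume "a \<in> (\<lambda>r. of_real r * \<i>) ` I" "b \<in> (\<lambda>r. - of_real r) ` I"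
      "c \<in> (\<lambda>r. - of_real r * \<i>) ` I" "q \<in> of_real ` I"
    then have "admissible a b c q"
      unfolding I_def image_iff by (metis admissible_on_rays greaterThanLessThan_iff)
    then have "eval_poly5 a b c q x P = 0"
      by (rule assms)
    then show "eval_at (eval_at (eval_at (eval_at (eval_at e a) b) c) q) x P = 0"
      using e by (simp add: eval_poly5_eq_eval_at)
  qed
  ultimately show ?thesis
    unfolding separating_def by simp
qed


section \<open>The coefficients of the basic hypergeometric series\<close>

lemma mult_power_neq_1:
  assumes "u \<notin> qpowers q" "q \<noteq> 0"
  shows "u * q ^ n \<noteq> 1"
proof
  assume "u * q ^ n = 1"
  then have "u = q powi (- int n)"
    using assms(2) by (simp add: power_int_minus field_simps)
  then show False
    using assms(1) by (auto simp: qpowers_def)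
qed

lemma power_notin_qpowers: "u \<notin> qpowers q \<Longrightarrow> q ^ n \<noteq> u"
  by (metis qpowers_def power_int_of_nat rangeI)

lemma mult_q_in_qpowers_iff:
  assumes "q \<noteq> 0"
  shows "u * q \<in> qpowers q \<longleftrightarrow> u \<in> qpowers q"
proof
  assume "u * q \<in> qpowers q"
  then obtain n where "u * q = q powi n"
    by (auto simp: qpowers_def)
  then have "u = q powi (n - 1)"
    using assms by (simp add: power_int_diff field_simps)
  then show "u \<in> qpowers q"
    by (auto simp: qpowers_def)
next
  assume "u \<in> qpowers q"
  then obtain n where "u = q powi n"
    by (auto simp: qpowers_def)
  then have "u * q = q powi (n + 1)"
    using assms by (simp add: power_int_add)
  then show "u * q \<in> qpowers q"
    by (auto simp: qpowers_def)
qed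

lemma admissible_shift: "admissible a b c q \<Longrightarrow> admissible (a * q) (b * q) (c * q) q"
  by (auto simp: admissible_def mult_q_in_qpowers_iff)

lemma qpoch_Suc: "qpoch q u (Suc n) = qpoch q u n * (1 - u * q ^ n)"
  by (simp add: qpoch_def)

lemma qpoch_shift: "(1 - u) * qpoch q (u * q) n = qpoch q u n * (1 - u * q ^ n)"
proof -
  have "(1 - u) * qpoch q (u * q) n = qpoch q u (Suc n)"
    unfolding qpoch_def by (subst prod.lessThan_Suc_shift) (simp add: mult.assoc)
  then show ?thesis
    by (simp add: qpoch_Suc)
qed

lemma qpoch_nonzero: "u \<notin> qpowers q \<Longrightarrow> q \<noteq> 0 \<Longrightarrow> qpoch q u n \<noteq> 0"
  by (auto simp: qpoch_def dest: mult_power_neq_1)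

lemma power_neq_1_if_norm_less_1:
  fixes q :: complex
  assumes "norm q < 1" "n > 0"
  shows "q ^ n \<noteq> 1"
proof
  assume "q ^ n = 1"
  then have "norm q ^ n = 1"
    by (metis norm_one norm_power)
  then show False
    using power_Suc_less_one[of "norm q" "n - 1"] assms
    by (cases "norm q = 0") (auto simp: power_0_left)
qed

lemma qpoch_q_nonzero: "norm q < 1 \<Longrightarrow> qpoch q q n \<noteq> 0"
  using power_neq_1_if_norm_less_1[of q "Suc _"] by (auto simp: qpoch_def)

definition qcoeff :: "complex \<Rightarrow> complex \<Rightarrow> complex \<Rightarrow> complex \<Rightarrow> nat \<Rightarrow> complex" where
  "qcoeff a b c q n = qpoch q a n * qpoch q b n / (qpoch q q n * qpoch q c n)"

lemma qcoeff_nonzero: "admissible a b c q \<Longrightarrow> qcoeff a b c q n \<noteq> 0"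
  by (auto simp: qcoeff_def admissible_def qpoch_nonzero qpoch_q_nonzero)

lemma qcoeff_Suc:
  "qcoeff a b c q (Suc n) = qcoeff a b c q n *
     ((1 - a * q ^ n) * (1 - b * q ^ n) / ((1 - q ^ Suc n) * (1 - c * q ^ n)))"
  by (simp add: qcoeff_def qpoch_Suc mult_ac)

lemma conv_radius_qcoeff:
  assumes adm: "admissible a b c q"
  shows "conv_radius (qcoeff a b c q) = 1"
proof (rule conv_radius_ratio_limit_nonzero)
  have q: "norm q < 1" using adm by (simp add: admissible_def)
  have "(\<lambda>n. norm ((1 - q ^ Suc n) * (1 - c * q ^ n) / ((1 - a * q ^ n) * (1 - b * q ^ n))))
          \<longlonglongrightarrow> norm ((1 - 0) * (1 - c * 0) / ((1 - a * 0) * (1 - b * 0)))"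
    by (intro tendsto_intros LIMSEQ_power_zero q LIMSEQ_Suc[OF LIMSEQ_power_zero]) auto
  moreover have "norm ((1 - q ^ Suc n) * (1 - c * q ^ n) / ((1 - a * q ^ n) * (1 - b * q ^ n)))
      = norm (qcoeff a b c q n) / norm (qcoeff a b c q (Suc n))" for n
    using qcoeff_nonzero[OF adm, of n] unfolding qcoeff_Suc norm_mult norm_divide
    by (simp add: mult_ac)
  ultimately show "(\<lambda>n. norm (qcoeff a b c q n) / norm (qcoeff a b c q (Suc n))) \<longlonglongrightarrow> 1"
    by simp
qed (auto simp: one_ereal_def)

lemma eval_fps_qcoeff: "eval_fps (Abs_fps (qcoeff a b c q)) x = qphi a b c q x"
  by (simp add: eval_fps_def qphi_def qcoeff_def)


section \<open>Independence over the polynomials in x\<close>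

locale admissible_parameters =
  fixes a b c q :: complex
  assumes adm: "admissible a b c q"
begin

lemma q: "q \<noteq> 0" "norm q < 1"
  using adm by (auto simp: admissible_def)

lemma a_neq_b: "a \<noteq> b"
proof
  assume "a = b"
  then have "a / b = q powi 0"
    using adm by (simp add: admissible_def)
  then show False
    using adm unfolding admissible_def qpowers_def by blast
qed

lemma roots:
  assumes "r \<in> {a, b}"
  shows "r \<noteq> 0" "q ^ n \<noteq> r" "c * q ^ n \<noteq> r"
proof -
  show r: "r \<noteq> 0" and "q ^ n \<noteq> r"
    using assms adm by (auto simp: admissible_def dest: power_notin_qpowers)
  have "c / r \<notin> qpowers q"
    using assms adm by (auto simp: admissible_def)
  from mult_power_neq_1[OF this q(1), of n] show "c * q ^ n \<noteq> r"
    using r by (simp add: field_simps)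
qed

text \<open>The quotients of the coefficients of the two series by \<open>e\<^sub>n\<close> are polynomials in \<open>q\<^sup>n\<close>. With
  the coefficients of \<open>\<phi>(a, b; c; q, x)\<close> in place of \<open>e\<^sub>n\<close>, the other series would have a
  denominator \<open>1 - cq\<^sup>n\<close>.\<close>

definition e :: "nat \<Rightarrow> complex" where
  "e n = qcoeff a b c q n / (1 - c * q ^ n)"

lemma c_factor_nonzero: "1 - c * q ^ n \<noteq> 0"
  using mult_power_neq_1[of c q n] adm by (auto simp: admissible_def)

lemma e_nonzero: "e n \<noteq> 0"
  using qcoeff_nonzero[OF adm] c_factor_nonzero by (simp add: e_def)

definition kappa :: complex where "kappa = (1 - c) / ((1 - a) * (1 - b))"

lemma one_minus_nonzero: "1 - a \<noteq> 0" "1 - b \<noteq> 0" "1 - c \<noteq> 0"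
  using roots(2)[of a 0] roots(2)[of b 0] c_factor_nonzero[of 0] by auto

lemma qcoeff_eq: "qcoeff a b c q n = (1 - c * q ^ n) * e n"
  using c_factor_nonzero by (simp add: e_def)

lemma qcoeff_shift_eq:
  "qcoeff (a * q) (b * q) (c * q) q n = kappa * ((1 - a * q ^ n) * (1 - b * q ^ n) * e n)"
proof -
  have "qpoch q (u * q) n = qpoch q u n * (1 - u * q ^ n) / (1 - u)" if "1 - u \<noteq> 0" for u
    using qpoch_shift[of u q n] that by (simp add: field_simps)
  then show ?thesis
    using one_minus_nonzero c_factor_nonzero[of n]
    by (simp add: qcoeff_def e_def kappa_def mult_ac)
qed

lemma e_Suc:
  "e (Suc n) * ((1 - q ^ Suc n) * (1 - c * q ^ Suc n)) = e n * ((1 - a * q ^ n) * (1 - b * q ^ n))"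
proof -
  have "1 - q ^ Suc n \<noteq> 0"
    using power_neq_1_if_norm_less_1[OF q(2), of "Suc n"] by auto
  then show ?thesis
    using c_factor_nonzero[of n] c_factor_nonzero[of "Suc n"]
    by (simp add: e_def qcoeff_Suc del: power_Suc)
qed

text \<open>The factors occurring in the formulas above, as polynomials in \<open>z\<close>; at \<open>z = q\<^sup>n\<close> with \<open>n \<ge> i\<close>
  they take the values belonging to the index \<open>n - i\<close>, since \<open>q\<^sup>n\<^sup>-\<^sup>i = z/q\<^sup>i\<close>.\<close>

definition A :: "nat \<Rightarrow> complex poly" where "A i = [:1, - (a / q ^ i):] * [:1, - (b / q ^ i):]"
definition B :: "nat \<Rightarrow> complex poly" where "B i = [:1, - (1 / q ^ i):] * [:1, - (c / q ^ i):]"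
definition C :: "nat \<Rightarrow> complex poly" where "C i = [:1, - (c / q ^ i):]"

text \<open>Dividing \<open>\<Sum>i\<le>d. p\<^sub>i(z) e\<^sub>n\<^sub>-\<^sub>i\<close> by \<open>e\<^sub>n\<^sub>-\<^sub>d\<close> gives a rational function of \<open>z = q\<^sup>n\<close>; this is its
  numerator over the denominator \<open>B\<^sub>0 \<cdots> B\<^sub>d\<^sub>-\<^sub>1\<close> (see \<open>cleared_eq_convolution\<close>).\<close>

primrec cleared :: "(nat \<Rightarrow> complex poly) \<Rightarrow> nat \<Rightarrow> complex poly" where
  "cleared p 0 = p 0"
| "cleared p (Suc d) = A (Suc d) * cleared p d + p (Suc d) * (\<Prod>i<Suc d. B i)"

lemma
  assumes "i \<le> n"
  shows poly_A_power: "poly (A i) (q ^ n) = (1 - a * q ^ (n - i)) * (1 - b * q ^ (n - i))"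
    and poly_B_power: "poly (B i) (q ^ n) = (1 - q ^ (n - i)) * (1 - c * q ^ (n - i))"
    and poly_C_power: "poly (C i) (q ^ n) = 1 - c * q ^ (n - i)"
  using q assms by (simp_all add: A_def B_def C_def power_diff field_simps)

lemma cleared_eq_convolution:
  "d \<le> n \<Longrightarrow> poly (cleared p d) (q ^ n) * e (n - d) =
     (\<Prod>i<d. poly (B i) (q ^ n)) * (\<Sum>i\<le>d. poly (p i) (q ^ n) * e (n - i))"
proof (induction d)
  case 0
  then show ?case by simp
next
  case (Suc d)
  have nd: "n - d = Suc (n - Suc d)"
    using Suc.prems by simp
  have A: "poly (A (Suc d)) (q ^ n) * e (n - Suc d) = poly (B d) (q ^ n) * e (n - d)"
    using e_Suc[of "n - Suc d"] Suc.prems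
    by (simp add: poly_A_power poly_B_power nd del: power_Suc) (simp add: mult_ac)
  have "poly (cleared p (Suc d)) (q ^ n) * e (n - Suc d) =
      (poly (A (Suc d)) (q ^ n) * e (n - Suc d)) * poly (cleared p d) (q ^ n) +
      poly (p (Suc d)) (q ^ n) * (\<Prod>i<Suc d. poly (B i) (q ^ n)) * e (n - Suc d)"
    by (simp add: poly_prod algebra_simps)
  also have "\<dots> = poly (B d) (q ^ n) * (poly (cleared p d) (q ^ n) * e (n - d)) +
      poly (p (Suc d)) (q ^ n) * (\<Prod>i<Suc d. poly (B i) (q ^ n)) * e (n - Suc d)"
    unfolding A by (simp add: mult_ac)
  also have "\<dots> = (\<Prod>i<Suc d. poly (B i) (q ^ n)) *
      (\<Sum>i\<le>Suc d. poly (p i) (q ^ n) * e (n - i))"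
    using Suc by (simp add: algebra_simps)
  finally show ?case .
qed

lemma infinite_powers_q: "infinite ((\<lambda>n. q ^ n) ` {d..})"
proof -
  have "inj (\<lambda>n. norm q ^ n)"
    using q power_strict_decreasing[of _ _ "norm q"]
    by (intro linorder_injI) (metis order_less_irrefl zero_less_norm_iff)
  then have "inj (\<lambda>n. q ^ n)"
    by (auto simp: inj_def norm_power[symmetric])
  then show ?thesis
    using infinite_Ici[of d] by (metis finite_imageD inj_on_subset subset_UNIV)
qed

text \<open>A relation between coefficients for all large \<open>n\<close> becomes a polynomial identity in \<open>z\<close>,
  which can then be evaluated away from the powers of \<open>q\<close>.\<close>

lemma cleared_eq_0I:
  assumes "\<And>n. d \<le> n \<Longrightarrow> (\<Sum>i\<le>d. poly (p i) (q ^ n) * e (n - i)) = 0"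
  shows "cleared p d = 0"
proof -
  have "poly (cleared p d) (q ^ n) = 0" if "d \<le> n" for n
    using cleared_eq_convolution[OF that, of p] assms[OF that] e_nonzero[of "n - d"] by simp
  then have "(\<lambda>n. q ^ n) ` {d..} \<subseteq> {z. poly (cleared p d) z = 0}"
    by auto
  then show ?thesis
    using infinite_powers_q poly_roots_finite finite_subset by blast
qed

text \<open>At the roots \<open>q\<^sup>d/a\<close> and \<open>q\<^sup>d/b\<close> of \<open>A d\<close> only the last summand survives.\<close>

lemma poly_cleared_root:
  assumes "r \<in> {a, b}"
  shows "poly (cleared p d) (q ^ d / r) =
           poly (p d) (q ^ d / r) * (\<Prod>i<d. poly (B i) (q ^ d / r))"
proof (cases d)
  case (Suc d')
  have "poly (A d) (q ^ d / r) = 0"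
    using assms roots(1)[OF assms] q by (auto simp: A_def)
  then show ?thesis
    using Suc by (simp add: poly_prod)
qed simp

lemma prod_B_root_nonzero:
  assumes "r \<in> {a, b}"
  shows "(\<Prod>i<d. poly (B i) (q ^ d / r)) \<noteq> 0"
proof -
  have "poly (B i) (q ^ d / r) \<noteq> 0" if "i < d" for i
  proof -
    have "poly (B i) (q ^ d / r) = (1 - q ^ (d - i) / r) * (1 - c * q ^ (d - i) / r)"
      using that q roots(1)[OF assms] by (simp add: B_def power_diff field_simps)
    then show ?thesis
      using roots(1)[OF assms] roots(2,3)[OF assms, of "d - i"] by simp
  qed
  then show ?thesis by simp
qed

lemma poly_BC_root:
  assumes "r \<in> {a, b}"
  shows "poly (B d) (q ^ d / r) = (1 - 1 / r) * (1 - c / r)"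
    and "poly (C d) (q ^ d / r) = 1 - c / r"
  using q roots(1)[OF assms] by (simp_all add: B_def C_def field_simps)

text \<open>The coefficients vanish from the top down. The summand with index \<open>d\<close> is \<open>u\<^sub>d A\<^sub>d + v\<^sub>d C\<^sub>d\<close>
  times \<open>B\<^sub>0 \<cdots> B\<^sub>d\<^sub>-\<^sub>1\<close>, and all others are divisible by \<open>A\<^sub>d\<close>. At a root of \<open>A\<^sub>d\<close> only the term with
  \<open>v\<^sub>d\<close> remains, so \<open>v\<^sub>d = 0\<close>. Now \<open>A\<^sub>d\<close> divides the whole polynomial, and at the roots
  \<open>q\<^sup>d\<^sup>-\<^sup>1/a\<close> and \<open>q\<^sup>d\<^sup>-\<^sup>1/b\<close> of \<open>A\<^sub>d\<^sub>-\<^sub>1\<close> the quotient retains only \<open>v\<^sub>d\<^sub>-\<^sub>1\<close> and \<open>u\<^sub>d\<close>. The two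
  resulting equations \<open>v\<^sub>d\<^sub>-\<^sub>1 + u\<^sub>d (1 - 1/a) = 0 = v\<^sub>d\<^sub>-\<^sub>1 + u\<^sub>d (1 - 1/b)\<close> force \<open>u\<^sub>d = 0\<close> because
  \<open>a \<noteq> b\<close>. What is left of the quotient is the polynomial of index \<open>d - 1\<close>.\<close>

lemma cleared_eq_0D:
  assumes "cleared (\<lambda>i. smult (u i) (A i) + smult (v i) (C i)) d = 0" "i \<le> d"
  shows "u i = 0 \<and> v i = 0"
  using assms
proof (induction d)
  define p where "p = (\<lambda>i. smult (u i) (A i) + smult (v i) (C i))"
  have A_nz: "A d \<noteq> 0" for d
    by (simp add: A_def)
  have A_root: "poly (A d) (q ^ d / r) = 0" if "r \<in> {a, b}" for d r
    using that roots(1)[OF that] q by (auto simp: A_def)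
  have C_root: "1 - c / r \<noteq> 0" if "r \<in> {a, b}" for r
    using roots(1)[OF that] roots(3)[OF that, of 0] by simp
  have v: "v d = 0" if "cleared p d = 0" for d
    using poly_cleared_root[of a p d] prod_B_root_nonzero[of a d] that
      A_root[of a d] C_root[of a] poly_BC_root(2)[of a d] roots(1)[of a]
    by (simp add: p_def)
  {
    case 0
    then have "v 0 = 0"
      using v[of 0] by (simp add: p_def)
    then show ?case
      using 0 A_nz by simp
  next
    case (Suc d)
    have cl: "cleared p (Suc d) = 0"
      using Suc.prems by (simp add: p_def)
    from v[OF cl] have v0: "v (Suc d) = 0" .
    have "A (Suc d) * (cleared p d + smult (u (Suc d)) (\<Prod>i<Suc d. B i)) = cleared p (Suc d)"
      by (simp add: p_def v0 algebra_simps)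
    with cl A_nz have quot: "cleared p d + smult (u (Suc d)) (\<Prod>i<Suc d. B i) = 0"
      by simp
    have eq: "v d + u (Suc d) * (1 - 1 / r) = 0" if r: "r \<in> {a, b}" for r
    proof -
      define z where "z = q ^ d / r"
      have "0 = poly (cleared p d) z + u (Suc d) * (\<Prod>i<Suc d. poly (B i) z)"
        using arg_cong[OF quot, of "\<lambda>P. poly P z"] by (simp add: poly_prod)
      also have "\<dots> = (\<Prod>i<d. poly (B i) z) * (poly (p d) z + u (Suc d) * poly (B d) z)"
        using poly_cleared_root[OF r, of p d] by (simp add: z_def algebra_simps)
      also have "poly (p d) z + u (Suc d) * poly (B d) z =
          (1 - c / r) * (v d + u (Suc d) * (1 - 1 / r))"
        by (simp add: p_def z_def A_root[OF r] poly_BC_root[OF r])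
          (simp add: algebra_simps diff_divide_distrib)
      finally show ?thesis
        using prod_B_root_nonzero[OF r, of d] C_root[OF r] roots(1)[OF r] by (simp add: z_def)
    qed
    have "u (Suc d) * (1 / a - 1 / b) = 0"
      using eq[of a] eq[of b] by (simp add: algebra_simps)
    then have u0: "u (Suc d) = 0"
      using a_neq_b roots(1)[of a] roots(1)[of b] by (simp add: field_simps)
    show ?case
    proof (cases "i = Suc d")
      case True
      then show ?thesis using u0 v0 by simp
    next
      case False
      then show ?thesis
        using Suc.IH Suc.prems(2) quot u0 by (simp add: p_def)
    qed
  }
qed

lemma qphi_independent:
  assumes "\<And>x. norm x < 1 \<Longrightarrow>
    poly U x * qphi (a * q) (b * q) (c * q) q x + poly V x * qphi a b c q x = 0"
  shows "U = 0 \<and> V = 0"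
proof -
  define F where "F = Abs_fps (qcoeff a b c q)"
  define G where "G = Abs_fps (qcoeff (a * q) (b * q) (c * q) q)"
  define H where "H = fps_of_poly U * G + fps_of_poly V * F"
  have radius: "fps_conv_radius F = 1" "fps_conv_radius G = 1"
    using conv_radius_qcoeff adm admissible_shift[OF adm]
    by (simp_all add: F_def G_def fps_conv_radius_def)
  have mult: "fps_conv_radius (fps_of_poly P * K) \<ge> 1" if "fps_conv_radius K = 1"
    for P and K :: "complex fps"
    using fps_conv_radius_mult[of "fps_of_poly P" K] that by simp
  have radius_H: "fps_conv_radius H \<ge> 1"
    using fps_conv_radius_add[of "fps_of_poly U * G" "fps_of_poly V * F"]
      mult[OF radius(1), of V] mult[OF radius(2), of U]
    unfolding H_def by (meson min.boundedI order_trans)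
  have "eval_fps H x = 0" if x: "norm x < 1" for x
  proof -
    have x1: "ereal (norm x) < 1"
      using x by (simp add: one_ereal_def)
    have less: "ereal (norm x) < fps_conv_radius (fps_of_poly P * K)"
      if "fps_conv_radius K = 1" for P and K :: "complex fps"
      using mult[OF that, of P] x1 by (rule order_less_le_trans[rotated])
    have "eval_fps H x = poly U x * eval_fps G x + poly V x * eval_fps F x"
      using less[OF radius(1)] less[OF radius(2)] x1
      by (simp add: H_def eval_fps_add eval_fps_mult radius)
    then show ?thesis
      using assms[OF x] by (simp add: F_def G_def eval_fps_qcoeff)
  qed
  then have "eventually (\<lambda>x. eval_fps H x = eval_fps 0 x) (nhds 0)"
    unfolding eventually_nhds_metric by (intro exI[of _ 1]) simp
  moreover have "fps_conv_radius H > 0"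
    using radius_H by (rule order_less_le_trans[rotated]) simp
  ultimately have "H = 0"
    by (intro eval_fps_eqD) simp_all
  define d where "d = max (degree U) (degree V)"
  have "cleared (\<lambda>i. smult (coeff U i * kappa) (A i) + smult (coeff V i) (C i)) d = 0"
  proof (rule cleared_eq_0I)
    fix n assume n: "d \<le> n"
    have beyond: "coeff U i = 0 \<and> coeff V i = 0" if "i \<notin> {..d}" for i
      using that by (auto simp: d_def coeff_eq_0)
    have "(\<Sum>i\<le>d. poly (smult (coeff U i * kappa) (A i) + smult (coeff V i) (C i)) (q ^ n) * e (n - i))
        = (\<Sum>i\<le>d. coeff U i * fps_nth G (n - i) + coeff V i * fps_nth F (n - i))"
      using n by (intro sum.cong refl)
        (simp add: poly_A_power poly_C_power F_def G_def qcoeff_eq qcoeff_shift_eq algebra_simps)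
    also have "\<dots> = (\<Sum>i=0..n. coeff U i * fps_nth G (n - i) + coeff V i * fps_nth F (n - i))"
      using n by (intro sum.mono_neutral_left) (auto simp: beyond)
    also have "\<dots> = fps_nth H n"
      by (simp add: H_def fps_mult_nth sum.distrib)
    finally show "(\<Sum>i\<le>d. poly (smult (coeff U i * kappa) (A i) + smult (coeff V i) (C i)) (q ^ n)
        * e (n - i)) = 0"
      using \<open>H = 0\<close> by simp
  qed
  from cleared_eq_0D[OF this, of "degree U"] cleared_eq_0D[OF this, of "degree V"]
  have "coeff U (degree U) * kappa = 0" "coeff V (degree V) = 0"
    by (simp_all add: d_def)
  moreover have "kappa \<noteq> 0"
    using one_minus_nonzero by (simp add: kappa_def)
  ultimately show ?thesis
    by simp
qed

end


section \<open>Uniqueness of the three term relation\<close>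

lemma poly5_relation_trivial:
  assumes "\<And>a b c q x. admissible a b c q \<Longrightarrow> norm x < 1 \<Longrightarrow>
    eval_poly5 a b c q x U * qphi (a * q) (b * q) (c * q) q x +
    eval_poly5 a b c q x V * qphi a b c q x = 0"
  shows "U = 0 \<and> V = 0"
proof -
  have "eval_poly5 a b c q x U = 0 \<and> eval_poly5 a b c q x V = 0"
    if "admissible a b c q" for a b c q x
  proof -
    interpret admissible_parameters a b c q
      by unfold_locales (fact that)
    show ?thesis
      using qphi_independent assms[OF that] unfolding eval_poly5_eq_eval_at
      unfolding eval_at_def[of "eval_at (eval_at (eval_at (eval_at of_rat a) b) c) q"]
      by (metis poly_0)
  qed
  then show ?thesis
    using poly5_eq_0I by blast
qed

lemma has_value_at_Fract:
  "eval_poly5 a b c q x D \<noteq> 0 \<Longrightarrow>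
     has_value_at (Fract N D) a b c q x (eval_poly5 a b c q x N / eval_poly5 a b c q x D)"
  unfolding has_value_at_def by blast

theorem theorem1:
  fixes k l m :: int and Q1 R1 Q2 R2 :: ratfun5
  assumes "three_term_relation k l m Q1 R1"
    and "three_term_relation k l m Q2 R2"
  shows "Q1 = Q2 \<and> R1 = R2"
proof -
  obtain N1 D1 where Q1: "Q1 = Fract N1 D1" "D1 \<noteq> 0" by (cases Q1)
  obtain N2 D2 where Q2: "Q2 = Fract N2 D2" "D2 \<noteq> 0" by (cases Q2)
  obtain M1 E1 where R1: "R1 = Fract M1 E1" "E1 \<noteq> 0" by (cases R1)
  obtain M2 E2 where R2: "R2 = Fract M2 E2" "E2 \<noteq> 0" by (cases R2)
  \<comment> \<open>The factor \<open>W\<close> in \<open>U\<close> and \<open>V\<close> makes the relation hold also where the rational functions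
    have no value.\<close>
  define W where "W = D1 * D2 * E1 * E2"
  define U where "U = W * (E1 * E2) * (N1 * D2 - N2 * D1)"
  define V where "V = W * (D1 * D2) * (M1 * E2 - M2 * E1)"
  have "U = 0 \<and> V = 0"
  proof (rule poly5_relation_trivial)
    fix a b c q x :: complex
    assume adm: "admissible a b c q" and x: "norm x < 1"
    define ev where "ev = eval_poly5 a b c q x"
    have hom: "semiring_hom ev"
      unfolding ev_def by (rule semiring_hom_eval_poly5)
    note ev_simps = semiring_hom_mult[OF hom] semiring_hom_diff[OF hom]
    define G where "G = qphi (a * q) (b * q) (c * q) q x"
    define F where "F = qphi a b c q x"
    have "ev U * G + ev V * F = 0"
    proof (cases "ev W = 0")
      case True
      then show ?thesis
        by (simp add: U_def V_def ev_simps)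
    next
      case False
      then have nz: "ev D1 \<noteq> 0" "ev D2 \<noteq> 0" "ev E1 \<noteq> 0" "ev E2 \<noteq> 0"
        by (auto simp: W_def ev_simps)
      have "ev N1 / ev D1 * G + ev M1 / ev E1 * F = ev N2 / ev D2 * G + ev M2 / ev E2 * F"
        using assms adm x nz has_value_at_Fract[of a b c q x]
        unfolding three_term_relation_def Q1(1) Q2(1) R1(1) R2(1) ev_def F_def G_def
        by metis
      then have "(ev N1 / ev D1 - ev N2 / ev D2) * G + (ev M1 / ev E1 - ev M2 / ev E2) * F = 0"
        by (simp add: algebra_simps)
      moreover have "ev U = ev W * ev W * (ev N1 / ev D1 - ev N2 / ev D2)"
        using nz by (simp add: U_def W_def ev_simps field_simps)
      moreover have "ev V = ev W * ev W * (ev M1 / ev E1 - ev M2 / ev E2)"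
        using nz by (simp add: V_def W_def ev_simps field_simps)
      ultimately show ?thesis
        by (metis (no_types, lifting) distrib_left mult.assoc mult_zero_right)
    qed
    then show "eval_poly5 a b c q x U * qphi (a * q) (b * q) (c * q) q x +
        eval_poly5 a b c q x V * qphi a b c q x = 0"
      by (simp add: ev_def F_def G_def)
  qed
  then have "N1 * D2 = N2 * D1" "M1 * E2 = M2 * E1"
    using Q1 Q2 R1 R2 by (auto simp: U_def V_def W_def)
  then show ?thesis
    using Q1 Q2 R1 R2 by (simp add: eq_fract)
qed

end
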